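(* Let $P_n$ be the path on $n\geq 1$ vertices. Then $$\chi_{md}(P_n)=\begin{cases}1,& n=1,\\ 2,& 2\leq n\leq 5,\\ 3,& 6\leq n\leq 10,\\ 4,& 11\leq n\leq 13,\\ \left\lceil \frac{n}{6}\right\rceil+2,& n\geq 14.\end{cases}$$
   Context: For a vertex $v$, $N[v]=N(v)\cup\{v\}$; $v$ dominates exactly the vertices of $N[v]$. A majority dominator coloring of $G$ is a proper vertex coloring such that for every vertex $v$ there is a color class $C$ with $|N[v]\cap C|\geq |C|/2$. $\chi_{md}(G)$ is the minimum number of color classes in a majority dominator coloring of $G$. *)

theory Defs
  imports Complex_Main "Graph_Theory.Pair_Digraph"
begin

text \<open>
  Finite simple graphs are the \<^locale>\<open>pair_graph\<close>s: symmetric loop-free relations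
  \<^const>\<open>parcs\<close> on a finite vertex set \<^const>\<open>pverts\<close>.
\<close>

definition closed_nbhd :: "'a pair_pre_digraph \<Rightarrow> 'a \<Rightarrow> 'a set" where
  "closed_nbhd G v = insert v {u. (v, u) \<in> parcs G}"

definition proper_coloring :: "'a pair_pre_digraph \<Rightarrow> ('a \<Rightarrow> nat) \<Rightarrow> bool" where
  "proper_coloring G c \<longleftrightarrow> (\<forall>(u, v) \<in> parcs G. c u \<noteq> c v)"

text \<open>
  Only colors that are actually used give a class. In particular the empty set is never a
  color class; every vertex would dominate half of it vacuously.
\<close>

definition color_classes :: "'a pair_pre_digraph \<Rightarrow> ('a \<Rightarrow> nat) \<Rightarrow> 'a set set" where
  "color_classes G c = (\<lambda>i. {v \<in> pverts G. c v = i}) ` c ` pverts G"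

definition majority_dominator_coloring :: "'a pair_pre_digraph \<Rightarrow> ('a \<Rightarrow> nat) \<Rightarrow> bool" where
  "majority_dominator_coloring G c \<longleftrightarrow>
     proper_coloring G c \<and>
     (\<forall>v \<in> pverts G. \<exists>C \<in> color_classes G c.
        real (card (closed_nbhd G v \<inter> C)) \<ge> real (card C) / 2)"

definition md_chromatic_number :: "'a pair_pre_digraph \<Rightarrow> nat" where
  "md_chromatic_number G =
     (LEAST k. \<exists>c. majority_dominator_coloring G c \<and> card (color_classes G c) = k)"

text \<open>The minimum is attained: giving every vertex its own color is always admissible.\<close>

lemma (in pair_graph) md_chromatic_number_attained:
  "\<exists>c. majority_dominator_coloring G c \<and> card (color_classes G c) = md_chromatic_number G"
proof -
  obtain c :: "'a \<Rightarrow> nat" where c: "inj_on c (pverts G)"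
    using finite_imp_inj_to_nat_seg[OF pair_finite_verts] by auto
  have "proper_coloring G c"
    unfolding proper_coloring_def
    using c pair_no_loops in_arcsD1 in_arcsD2 by (fastforce dest: inj_onD)
  moreover have "\<exists>C \<in> color_classes G c.
      real (card (closed_nbhd G v \<inter> C)) \<ge> real (card C) / 2" if v: "v \<in> pverts G" for v
  proof
    have "{u \<in> pverts G. c u = c v} = {v}"
      using c v by (auto dest: inj_onD)
    then show "{v} \<in> color_classes G c"
      using v unfolding color_classes_def by force
    show "real (card (closed_nbhd G v \<inter> {v})) \<ge> real (card {v}) / 2"
      by (simp add: closed_nbhd_def)
  qed
  ultimately have "majority_dominator_coloring G c"
    unfolding majority_dominator_coloring_def by blast
  then have "\<exists>k c. majority_dominator_coloring G c \<and> card (color_classes G c) = k"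
    by blast
  then show ?thesis
    unfolding md_chromatic_number_def by (rule LeastI_ex)
qed

definition path_graph :: "nat \<Rightarrow> nat pair_pre_digraph" where
  "path_graph n =
     \<lparr>pverts = {1..n}, parcs = {(i, j). i \<in> {1..n} \<and> j \<in> {1..n} \<and> (j = i + 1 \<or> i = j + 1)}\<rparr>"

lemma pair_graph_path_graph: "pair_graph (path_graph n)"
proof
  have "parcs (path_graph n) \<subseteq> {1..n} \<times> {1..n}"
    by (auto simp: path_graph_def)
  then show "finite (parcs (path_graph n))"
    by (rule finite_subset) simp
qed (auto simp: path_graph_def symmetric_def sym_def)

end

theory Submission
  imports Defs
begin

text \<open>
  A color class of a path is independent, so it meets \<open>N[v]\<close> in at most two vertices, and in two
  only if these are the two neighbours of \<open>v\<close>. Hence a class of size one or two (small) dominates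
  at most three times as many vertices as it has, a class of size three or four (mid) dominates at
  most three, namely vertices between two of its members, and a larger class (big) dominates none.

  With two big classes, or one big and two mid ones, counting dominated vertices gives the lower
  bound. With one big class and at most one mid class, every vertex of the big class except
  possibly \<open>n\<close> is followed within distance two by its own small vertex, so \<open>n\<close> is at most twice
  the number of small vertices, plus one, plus four per mid class. Without big classes, the size
  bound on the classes suffices
  (for a single mid class, together with the argument just given for the big one), except for
  \<open>n = 14\<close> with three mid classes and one pair, which a parity argument excludes.

  For the upper bound, take the vertices congruent to \<open>2\<close> modulo \<open>3\<close> (and \<open>n\<close> if it is congruent
  to \<open>1\<close>) in consecutive pairs and give the residues \<open>0\<close> and \<open>1\<close> one color each.
\<close>

section \<open>Color classes and dominator colorings of paths\<close>

definition color_class :: "nat \<Rightarrow> (nat \<Rightarrow> nat) \<Rightarrow> nat \<Rightarrow> nat set" where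
  "color_class n c i = {v \<in> {1..n}. c v = i}"

lemma finite_color_class [simp]: "finite (color_class n c i)"
  by (simp add: color_class_def)

lemma color_class_pos: "i \<in> c ` {1..n} \<Longrightarrow> 0 < card (color_class n c i)"
  by (auto simp: card_gt_0_iff color_class_def)

lemma color_classes_path: "color_classes (path_graph n) c = color_class n c ` c ` {1..n}"
  unfolding color_classes_def color_class_def path_graph_def by simp

lemma card_color_classes_path: "card (color_classes (path_graph n) c) = card (c ` {1..n})"
proof -
  have "inj_on (color_class n c) (c ` {1..n})"
  proof (rule inj_onI)
    fix i j assume "i \<in> c ` {1..n}" and eq: "color_class n c i = color_class n c j"
    then obtain v where "v \<in> color_class n c i"
      by (auto simp: color_class_def)
    moreover from this have "v \<in> color_class n c j"
      unfolding eq .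
    ultimately show "i = j"
      by (simp add: color_class_def)
  qed
  then show ?thesis
    by (simp add: color_classes_path card_image)
qed

text \<open>For \<open>v = 1\<close> the interval also contains the non-vertex \<open>0\<close>, which lies in no class.\<close>

lemma closed_nbhd_path_Int_class:
  "v \<in> {1..n} \<Longrightarrow> closed_nbhd (path_graph n) v \<inter> color_class n c i = {v - 1..v + 1} \<inter> color_class n c i"
  by (auto simp: closed_nbhd_def path_graph_def color_class_def)

text \<open>Doubling the intersection instead of halving the class keeps all counting in linear
  arithmetic over the naturals.\<close>

locale path_md_coloring =
  fixes n :: nat and c :: "nat \<Rightarrow> nat"
  assumes adjacent: "1 \<le> v \<Longrightarrow> v < n \<Longrightarrow> c v \<noteq> c (v + 1)"
    and dominating: "v \<in> {1..n} \<Longrightarrow>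
      \<exists>i \<in> c ` {1..n}. card (color_class n c i) \<le> 2 * card ({v - 1..v + 1} \<inter> color_class n c i)"

lemma majority_dominator_coloring_path_iff:
  "majority_dominator_coloring (path_graph n) c \<longleftrightarrow> path_md_coloring n c"
proof -
  have proper: "proper_coloring (path_graph n) c \<longleftrightarrow> (\<forall>v. 1 \<le> v \<longrightarrow> v < n \<longrightarrow> c v \<noteq> c (v + 1))"
    by (auto simp: proper_coloring_def path_graph_def)
  have half: "real x \<ge> real y / 2 \<longleftrightarrow> y \<le> 2 * x" for x y :: nat
    by linarith
  have verts: "pverts (path_graph n) = {1..n}"
    by (simp add: path_graph_def)
  show ?thesis
    unfolding majority_dominator_coloring_def path_md_coloring_def proper half color_classes_path verts
    by (simp add: closed_nbhd_path_Int_class Ball_def)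
qed

lemma md_chromatic_number_path_le:
  assumes "path_md_coloring n c" "c ` {1..n} \<subseteq> {..<k}"
  shows "md_chromatic_number (path_graph n) \<le> k"
proof -
  have "md_chromatic_number (path_graph n) \<le> card (c ` {1..n})"
    unfolding md_chromatic_number_def using assms(1)
    by (intro Least_le) (auto simp: majority_dominator_coloring_path_iff card_color_classes_path)
  also have "\<dots> \<le> k"
    using card_mono[OF _ assms(2)] by simp
  finally show ?thesis .
qed

lemma md_chromatic_number_path_attained:
  obtains c where "path_md_coloring n c" "card (c ` {1..n}) = md_chromatic_number (path_graph n)"
  using pair_graph.md_chromatic_number_attained[OF pair_graph_path_graph]
  by (metis majority_dominator_coloring_path_iff card_color_classes_path)

subsection \<open>Lower bounds\<close>

text \<open>
  Here \<open>p\<close>, \<open>u\<close>, \<open>q\<close> and \<open>b\<close> are the numbers of classes of size two, of size one, of size three or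
  four, and of size at least five.
\<close>

lemma path_class_count_arith:
  fixes n p u q b k :: nat
  assumes "n \<le> 6 * p + 3 * u + 3 * q"
    and "b = 0 \<Longrightarrow> n \<le> 2 * p + u + 4 * q"
    and "b = 1 \<Longrightarrow> q \<le> 1 \<Longrightarrow> n \<le> 4 * p + 2 * u + 1 + 4 * q"
    and "b = 0 \<Longrightarrow> q = 1 \<Longrightarrow> n \<le> 4 * p + 2 * u + 1"
    and "14 \<le> n \<Longrightarrow> 2 * p + u \<le> 2 \<Longrightarrow> b \<noteq> 0"
    and "1 \<le> n \<Longrightarrow> p + u \<noteq> 0"
    and "k = p + u + q + b"
  shows "6 \<le> n \<Longrightarrow> 3 \<le> k" and "11 \<le> n \<Longrightarrow> 4 \<le> k" and "14 \<le> n \<Longrightarrow> n + 12 \<le> 6 * k"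
proof -
  show "6 \<le> n \<Longrightarrow> 3 \<le> k" "11 \<le> n \<Longrightarrow> 4 \<le> k"
    using assms by linarith+
  \<comment> \<open>This says that \<open>k\<close> is at least the ceiling of \<open>n / 6\<close>,
    plus two, without division.\<close>
  show "n + 12 \<le> 6 * k" if n: "14 \<le> n"
  proof (rule ccontr)
    assume less: "\<not> n + 12 \<le> 6 * k"
    then have bound: "6 * p + 6 * u + 6 * q + 6 * b < n + 12"
      using assms(7) by simp
    \<comment> \<open>With \<open>bound\<close> this gives
      \<open>3 * u + 3 * q + 6 * b < 12\<close>, so only a few values of \<open>u\<close>,
      \<open>q\<close> and \<open>b\<close> remain.\<close>
    note dom = assms(1)
    consider "b = 0" | "b = 1" "q \<le> 1" | "b = 1" "2 \<le> q" | "2 \<le> b"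
      by linarith
    then show False
    proof cases
      case 1
      have size: "n \<le> 2 * p + u + 4 * q" and two: "\<not> 2 * p + u \<le> 2"
        using assms(2,5) n 1 by blast+
      have "3 * u + 3 * q < 12"
        using bound dom 1 by linarith
      then consider "q = 0" | "q = 1" | "q = 2" | "q = 3" "u = 0"
        by linarith
      then show False
        using bound dom size two n 1 by cases linarith+
    next
      case 2
      have "n \<le> 4 * p + 2 * u + 1 + 4 * q"
        using assms(3) 2 by blast
      moreover have "3 * u + 3 * q < 6"
        using bound dom 2 by linarith
      then consider "q = 0" "u = 0" | "q = 1" "u = 0" | "q = 0" "u = 1"
        by linarith
      ultimately show False
        using bound dom n 2 by cases linarith+
    qed (use bound dom in linarith)+
  qed
qed

section \<open>Small, mid and big classes and the vertices they dominate\<close>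

context path_md_coloring
begin

abbreviation cls :: "nat \<Rightarrow> nat set" where
  "cls \<equiv> color_class n c"

definition small :: "nat set" where
  "small = {i \<in> c ` {1..n}. card (cls i) \<le> 2}"

definition mid :: "nat set" where
  "mid = {i \<in> c ` {1..n}. card (cls i) \<in> {3, 4}}"

definition big :: "nat set" where
  "big = {i \<in> c ` {1..n}. 5 \<le> card (cls i)}"

definition small_verts :: "nat set" where
  "small_verts = {v \<in> {1..n}. c v \<in> small}"

definition dominated :: "nat \<Rightarrow> nat set" where
  "dominated i = {v \<in> {1..n}. card (cls i) \<le> 2 * card ({v - 1..v + 1} \<inter> cls i)}"

lemma finite_parts [simp]: "finite small" "finite mid" "finite big" "finite small_verts" "finite (dominated i)"
  by (auto simp: small_def mid_def big_def small_verts_def dominated_def)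

lemma colors_eq: "c ` {1..n} = small \<union> mid \<union> big"
  by (auto simp: small_def mid_def big_def)

lemma disjoint_parts: "small \<inter> mid = {}" "small \<inter> big = {}" "mid \<inter> big = {}"
  by (auto simp: small_def mid_def big_def)

text \<open>If \<open>v\<close> were in the class, properness would keep both neighbours out and
  leave only one common vertex. So the two must be the neighbours, and \<open>v\<close> is
  interior.\<close>

lemma nbhd_Int_class:
  assumes "v \<in> {1..n}" "2 \<le> card ({v - 1..v + 1} \<inter> cls i)"
  shows "{v - 1..v + 1} \<inter> cls i = {v - 1, v + 1}" "1 < v" "v < n" "c (v - 1) = i" "c (v + 1) = i"
proof -
  let ?S = "{v - 1..v + 1} \<inter> cls i"
  have "v \<notin> cls i"
  proof
    assume v: "v \<in> cls i"
    have "v + 1 \<notin> cls i"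
      using v adjacent[of v] by (auto simp: color_class_def)
    moreover have "v - 1 \<notin> cls i" if "1 < v"
    proof -
      have "v - 1 < n" "1 \<le> v - 1"
        using that assms(1) by auto
      then show ?thesis
        using v adjacent[of "v - 1"] that by (auto simp: color_class_def)
    qed
    \<comment> \<open>For \<open>v = 1\<close> the left end of the interval is the non-vertex
      \<open>0\<close>.\<close>
    moreover have "0 \<notin> cls i"
      by (simp add: color_class_def)
    ultimately have neigh: "v + 1 \<notin> cls i" "v - 1 \<notin> cls i"
      by (metis, metis One_nat_def diff_is_0_eq not_less)
    have "?S \<subseteq> {v}"
    proof
      fix x assume "x \<in> ?S"
      then have "x \<noteq> v + 1" "x \<noteq> v - 1" "v - 1 \<le> x" "x \<le> v + 1"
        using neigh by auto
      then have "x = v"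
        by arith
      then show "x \<in> {v}"
        by simp
    qed
    then have "card ?S \<le> 1"
      using card_mono[of "{v}"] by auto
    then show False
      using assms(2) by simp
  qed
  have sub: "?S \<subseteq> {v - 1, v + 1}"
  proof
    fix x assume "x \<in> ?S"
    then have "x \<noteq> v" "v - 1 \<le> x" "x \<le> v + 1"
      using \<open>v \<notin> cls i\<close> by auto
    then have "x = v - 1 \<or> x = v + 1"
      by arith
    then show "x \<in> {v - 1, v + 1}"
      by simp
  qed
  show eq: "?S = {v - 1, v + 1}"
    using sub assms(2) by (intro card_seteq) (auto intro: order_trans[OF card_insert_le_m1])
  then have "v - 1 \<in> cls i" "v + 1 \<in> cls i"
    by auto
  then show "1 < v" "v < n" "c (v - 1) = i" "c (v + 1) = i"
    by (auto simp: color_class_def)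
qed

lemma card_nbhd_Int_class_le: "v \<in> {1..n} \<Longrightarrow> card ({v - 1..v + 1} \<inter> cls i) \<le> 2"
  using nbhd_Int_class(1)[of v i] by (cases "2 \<le> card ({v - 1..v + 1} \<inter> cls i)") (auto simp: card_insert_if)

text \<open>A class meets the interval at most twice, so one that dominates \<open>v\<close> has at
  most four members; above size two it needs both neighbours.\<close>

lemma dominated_cases:
  assumes v: "v \<in> {1..n}"
  obtains u where "u \<in> small_verts" "v - 1 \<le> u" "u \<le> v + 1"
  | "1 < v" "v < n" "c (v - 1) = c (v + 1)" "c (v - 1) \<in> mid"
proof -
  obtain i where i: "i \<in> c ` {1..n}" "card (cls i) \<le> 2 * card ({v - 1..v + 1} \<inter> cls i)"
    using dominating[OF v] by blast
  show ?thesis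
  proof (cases "card (cls i) \<le> 2")
    case True
    have "card ({v - 1..v + 1} \<inter> cls i) \<noteq> 0"
      using color_class_pos[OF i(1)] i(2) by linarith
    then obtain u where "u \<in> {v - 1..v + 1} \<inter> cls i"
      by (metis card.empty ex_in_conv)
    then show ?thesis
      using True i(1) by (intro that(1)[of u]) (auto simp: small_verts_def small_def color_class_def)
  next
    case False
    then have "2 \<le> card ({v - 1..v + 1} \<inter> cls i)"
      using i(2) by linarith
    note * = nbhd_Int_class[OF v this]
    have "card (cls i) \<le> 4"
      using i(2) card_nbhd_Int_class_le[OF v, of i] by linarith
    then show ?thesis
      using * False i(1) by (intro that(2)) (auto simp: mid_def)
  qed
qed

lemma card_dominated_small:
  assumes "card (cls i) \<le> 2"  "0 < card (cls i)"
  shows "card (dominated i) \<le> 3 * card (cls i)"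
proof -
  have "dominated i \<subseteq> (\<Union>x \<in> cls i. {x - 1..x + 1})"
  proof
    fix v assume "v \<in> dominated i"
    then have "card ({v - 1..v + 1} \<inter> cls i) \<noteq> 0"
      using assms(2) unfolding dominated_def by auto
    then obtain u where "u \<in> {v - 1..v + 1} \<inter> cls i"
      by (metis card.empty ex_in_conv)
    then show "v \<in> (\<Union>x \<in> cls i. {x - 1..x + 1})"
      by (intro UN_I[of u]) auto
  qed
  then have "card (dominated i) \<le> card (\<Union>x \<in> cls i. {x - 1..x + 1})"
    by (intro card_mono) auto
  also have "\<dots> \<le> (\<Sum>x \<in> cls i. card {x - 1..x + 1})"
    by (rule card_UN_le) simp
  also have "\<dots> \<le> (\<Sum>x \<in> cls i. 3)"
    by (rule sum_mono) simp
  finally show ?thesis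
    by simp
qed

text \<open>A dominated vertex lies between two members. Sending it to the right one is injective
  and never hits the least member.\<close>

lemma card_dominated_mid:
  assumes "3 \<le> card (cls i)"
  shows "card (dominated i) \<le> card (cls i) - 1"
proof -
  have ne: "cls i \<noteq> {}"
    using assms by auto
  have "Suc ` dominated i \<subseteq> cls i - {Min (cls i)}"
  proof
    fix x assume "x \<in> Suc ` dominated i"
    then obtain v where x: "x = v + 1" and v: "v \<in> {1..n}"
      and "card (cls i) \<le> 2 * card ({v - 1..v + 1} \<inter> cls i)"
      by (auto simp: dominated_def)
    then have "2 \<le> card ({v - 1..v + 1} \<inter> cls i)"
      using assms by linarith
    note * = nbhd_Int_class(1)[OF v this]
    then have "v - 1 \<in> cls i" "v + 1 \<in> cls i"
      by auto
    moreover from this have "Min (cls i) \<le> v - 1"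
      by (intro Min_le) simp_all
    then have "x \<noteq> Min (cls i)"
      using x by linarith
    ultimately show "x \<in> cls i - {Min (cls i)}"
      using x by simp
  qed
  then have "card (Suc ` dominated i) \<le> card (cls i - {Min (cls i)})"
    by (intro card_mono) auto
  then show ?thesis
    using ne by (simp add: card_image)
qed

lemma dominated_big:
  assumes "5 \<le> card (cls i)"
  shows "dominated i = {}"
proof -
  have "v \<notin> dominated i" if "v \<in> {1..n}" for v
    using card_nbhd_Int_class_le[OF that, of i] assms by (simp add: dominated_def)
  then show ?thesis
    by (auto simp: dominated_def)
qed

section \<open>Counting vertices and colors by class type\<close>

lemma card_vertices_of_colors:
  assumes "finite I"
  shows "card {v \<in> {1..n}. c v \<in> I} = (\<Sum>i \<in> I. card (cls i))"
proof -
  have "{v \<in> {1..n}. c v \<in> I} = (\<Union>i \<in> I. cls i)"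
    by (auto simp: color_class_def)
  then show ?thesis
    using assms by (simp add: card_UN_disjoint color_class_def disjoint_iff)
qed

lemma card_small_verts: "card small_verts = (\<Sum>i \<in> small. card (cls i))"
  unfolding small_verts_def by (rule card_vertices_of_colors) simp

lemma n_eq: "n = card small_verts + (\<Sum>i \<in> mid. card (cls i)) + (\<Sum>i \<in> big. card (cls i))"
proof -
  have "{v \<in> {1..n}. c v \<in> small \<union> mid \<union> big} = {1..n}"
    using colors_eq by auto
  then have "n = (\<Sum>i \<in> small \<union> mid \<union> big. card (cls i))"
    using card_vertices_of_colors[of "small \<union> mid \<union> big"] by simp
  also have "\<dots> = (\<Sum>i \<in> small. card (cls i)) + (\<Sum>i \<in> mid. card (cls i)) + (\<Sum>i \<in> big. card (cls i))"
    using disjoint_parts by (simp add: sum.union_disjoint Int_Un_distrib2)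
  finally show ?thesis
    by (simp add: card_small_verts)
qed

lemma sum_mid_le: "(\<Sum>i \<in> mid. card (cls i)) \<le> 4 * card mid"
proof -
  have "(\<Sum>i \<in> mid. card (cls i)) \<le> (\<Sum>i \<in> mid. 4)"
    by (intro sum_mono) (auto simp: mid_def)
  then show ?thesis
    by simp
qed

lemma card_colors: "card (c ` {1..n}) = card small + card mid + card big"
  unfolding colors_eq using disjoint_parts by (simp add: card_Un_disjoint Int_Un_distrib2)

lemma n_le_dominated: "n \<le> 3 * card small_verts + 3 * card mid"
proof -
  have "{1..n} \<subseteq> (\<Union>i \<in> small \<union> mid \<union> big. dominated i)"
  proof
    fix v assume v: "v \<in> {1..n}"
    then obtain i where "i \<in> c ` {1..n}" "v \<in> dominated i"
      using dominating[OF v] by (auto simp: dominated_def)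
    then show "v \<in> (\<Union>i \<in> small \<union> mid \<union> big. dominated i)"
      using colors_eq by blast
  qed
  then have "card {1..n} \<le> card (\<Union>i \<in> small \<union> mid \<union> big. dominated i)"
    by (intro card_mono) auto
  also have "\<dots> \<le> (\<Sum>i \<in> small \<union> mid \<union> big. card (dominated i))"
    by (rule card_UN_le) simp
  also have "\<dots> = (\<Sum>i \<in> small. card (dominated i)) + (\<Sum>i \<in> mid. card (dominated i)) + (\<Sum>i \<in> big. card (dominated i))"
    using disjoint_parts by (simp add: sum.union_disjoint Int_Un_distrib2)
  also have "(\<Sum>i \<in> big. card (dominated i)) = 0"
    by (simp add: big_def dominated_big)
  also have "(\<Sum>i \<in> mid. card (dominated i)) \<le> (\<Sum>i \<in> mid. 3)"
  proof (rule sum_mono)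
    fix i assume "i \<in> mid"
    then show "card (dominated i) \<le> 3"
      using card_dominated_mid[of i] by (auto simp: mid_def)
  qed
  also have "(\<Sum>i \<in> small. card (dominated i)) \<le> (\<Sum>i \<in> small. 3 * card (cls i))"
  proof (rule sum_mono)
    fix i assume "i \<in> small"
    then show "card (dominated i) \<le> 3 * card (cls i)"
      using card_dominated_small color_class_pos by (simp add: small_def)
  qed
  also have "\<dots> = 3 * card small_verts"
    by (simp add: card_small_verts sum_distrib_left)
  finally show ?thesis
    by simp
qed

section \<open>Bounding one class by the number of small vertices\<close>

text \<open>
  The successor of a vertex of color \<open>i\<close> is a small vertex, or has color \<open>j\<close>; in the latter
  case it can only be dominated by a small vertex right after it.
\<close>

lemma card_class_le:
  assumes "c ` {1..n} \<subseteq> small \<union> {i, j}" "i \<notin> small" "i \<notin> mid \<or> i = j"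
  shows "card (cls i) \<le> card small_verts + 1"
proof -
  define f where "f v = (if v + 1 \<in> small_verts then v + 1 else v + 2)" for v
  have small_i: "v \<notin> small_verts" if "c v = i" for v
    using that assms(2) by (simp add: small_verts_def)
  have f: "f v \<in> small_verts" if v: "v \<in> cls i - {n}" for v
  proof (cases "v + 1 \<in> small_verts")
    case False
    have v': "v \<ge> 1" "v < n" "c v = i" "v + 1 \<in> {1..n}"
      using v by (auto simp: color_class_def)
    have "c (v + 1) \<in> c ` {1..n}"
      using v'(4) by blast
    moreover have "c (v + 1) \<notin> small"
      using False v'(4) by (simp add: small_verts_def)
    moreover have "c (v + 1) \<noteq> i"
      using adjacent[of v] v' by metis
    ultimately have ji: "c (v + 1) = j" "i \<noteq> j"
      using assms(1) by blast+
    show ?thesis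
      using v'(4)
    proof (cases rule: dominated_cases)
      case (1 u)
      then have "u \<noteq> v" "u \<noteq> v + 1" "u \<in> small_verts" "v \<le> u" "u \<le> v + 2"
        using small_i v' False by auto
      then show ?thesis
        using False by (auto simp: f_def le_Suc_eq)
    next
      \<comment> \<open>Here \<open>v\<close> and \<open>v + 2\<close> would share a mid color, but
        the color of \<open>v\<close> is \<open>i\<close>, which is not mid since \<open>i\<close>
        and \<open>j\<close> differ.\<close>
      case 2
      then show ?thesis
        using v' assms(3) ji by simp
    qed
  qed (simp add: f_def)
  have "inj_on f (cls i - {n})"
  proof (rule inj_onI)
    fix x y assume xy: "x \<in> cls i - {n}" "y \<in> cls i - {n}" "f x = f y"
    \<comment> \<open>Two values of \<open>f\<close> can collide only at equal or consecutive
      arguments, and consecutive vertices differ in color.\<close>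
    then have "x \<noteq> y + 1" "y \<noteq> x + 1"
      using adjacent[of x] adjacent[of y] by (auto simp: color_class_def)
    then show "x = y"
      using xy(3) by (auto simp: f_def split: if_splits)
  qed
  then have "card (cls i - {n}) \<le> card small_verts"
    using f by (intro card_inj_on_le) auto
  then show ?thesis
    \<comment> \<open>The extra one accounts for \<open>n\<close>, which has no successor.\<close>
    by (cases "n \<in> cls i") auto
qed

lemma n_le_one_big:
  assumes "card big = 1" "card mid \<le> 1"
  shows "n \<le> 2 * card small_verts + 1 + 4 * card mid"
proof -
  obtain i where i: "big = {i}"
    using assms(1) card_1_singletonE by blast
  obtain j where j: "mid \<subseteq> {j}" "i \<notin> mid"
  proof (cases "mid = {}")
    case False
    then obtain j where "mid = {j}"
      using assms(2) by (metis One_nat_def card_1_singletonE card_gt_0_iff finite_parts(2) le_antisym less_eq_Suc_le)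
    then show ?thesis
      using that i disjoint_parts by blast
  qed (use that in blast)
  have "i \<notin> small"
    using i disjoint_parts by blast
  then have "card (cls i) \<le> card small_verts + 1"
    using j i colors_eq by (intro card_class_le[of i j]) auto
  then show ?thesis
    using n_eq sum_mid_le i by simp
qed

text \<open>With \<open>i = j\<close> the argument for a big class applies to the only mid class.
  This excludes \<open>n = 6\<close> with one pair and one class of size four.\<close>

lemma n_le_one_mid:
  assumes "card big = 0" "card mid = 1"
  shows "n \<le> 2 * card small_verts + 1"
proof -
  obtain i where i: "mid = {i}"
    using assms(2) card_1_singletonE by blast
  have "big = {}"
    using assms(1) by simp
  then have "card (cls i) \<le> card small_verts + 1"
    using i colors_eq disjoint_parts by (intro card_class_le[of i i]) auto
  then show ?thesis
    using n_eq \<open>big = {}\<close> i by simp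
qed

text \<open>An end of the path does not lie between two vertices, so only a small class can dominate
  it.\<close>

lemma end_dominated:
  assumes "v \<in> {1, n}" "1 \<le> n"
  shows "\<exists>u \<in> small_verts. v - 1 \<le> u \<and> u \<le> v + 1"
proof -
  have "v \<in> {1..n}"
    using assms by auto
  then show ?thesis
    using assms by (cases rule: dominated_cases) auto
qed

text \<open>
  The ends force both small vertices into \<open>{1, 2, n - 1, n}\<close>, hence every vertex in between
  has two neighbours of the same color and the color of \<open>3\<close> propagates to \<open>5, 7, 9, 11\<close>.
\<close>

lemma big_nonempty:
  assumes "14 \<le> n" "card small_verts \<le> 2"
  shows "big \<noteq> {}"
proof -
  obtain x where x: "x \<in> small_verts" "x \<le> 2"
    using end_dominated[of 1] assms(1) by fastforce
  obtain y where y: "y \<in> small_verts" "n - 1 \<le> y"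
    using end_dominated[of n] assms(1) by fastforce
  have "{x, y} = small_verts"
    using x y assms by (intro card_seteq) auto
  \<comment> \<open>From \<open>n \<ge> 14\<close> follows \<open>y \<ge> 13\<close>.\<close>
  then have far: "z \<notin> small_verts" if "3 \<le> z" "z \<le> 12" for z
  proof -
    have "z \<noteq> x" "z \<noteq> y"
      using that x y assms(1) by linarith+
    then show ?thesis
      using \<open>{x, y} = small_verts\<close> by blast
  qed
  have step: "c (v - 1) = c (v + 1)" if "4 \<le> v" "v \<le> 11" for v
  proof -
    have "v \<in> {1..n}"
      using that assms(1) by simp
    then show ?thesis
    proof (cases rule: dominated_cases)
      case (1 z)
      then have "3 \<le> z" "z \<le> 12"
        using that by linarith+
      then show ?thesis
        using far 1 by blast
    qed
  qed
  have "c 3 = c 5" "c 5 = c 7" "c 7 = c 9" "c 9 = c 11"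
    using step[of 4] step[of 6] step[of 8] step[of 10] by simp_all
  then have "{3, 5, 7, 9, 11} \<subseteq> cls (c 3)"
    using assms(1) by (simp add: color_class_def)
  then have "card {3, 5, 7, 9, 11 :: nat} \<le> card (cls (c 3))"
    by (intro card_mono) auto
  then have "c 3 \<in> big"
    using assms(1) by (simp add: big_def)
  then show ?thesis
    by blast
qed

lemma two_le_card_colors:
  assumes "2 \<le> n"
  shows "2 \<le> card (c ` {1..n})"
proof -
  have "c 1 \<noteq> c 2"
    using adjacent[of 1] assms by (simp add: numeral_2_eq_2)
  then have "card {c 1, c 2} = 2"
    by simp
  moreover have "{c 1, c 2} \<subseteq> c ` {1..n}"
    using assms by auto
  ultimately show ?thesis
    by (metis card_mono finite_atLeastAtMost finite_imageI)
qed

lemma card_colors_ge: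
  shows "6 \<le> n \<Longrightarrow> 3 \<le> card (c ` {1..n})"
    and "11 \<le> n \<Longrightarrow> 4 \<le> card (c ` {1..n})"
    and "14 \<le> n \<Longrightarrow> n + 12 \<le> 6 * card (c ` {1..n})"
proof -
  define p where "p = card {i \<in> c ` {1..n}. card (cls i) = 2}"
  define u where "u = card {i \<in> c ` {1..n}. card (cls i) = 1}"
  define q where "q = card mid"
  define b where "b = card big"
  have small: "small = {i \<in> c ` {1..n}. card (cls i) = 2} \<union> {i \<in> c ` {1..n}. card (cls i) = 1}"
  proof -
    have "card (cls i) \<le> 2 \<longleftrightarrow> card (cls i) = 2 \<or> card (cls i) = 1" if "i \<in> c ` {1..n}" for i
      using color_class_pos[OF that] by linarith
    then show ?thesis
      unfolding small_def by blast
  qed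
  have "card small_verts = 2 * p + u"
    unfolding card_small_verts small p_def u_def by (subst sum.union_disjoint) auto
  note d = this
  have "card small = p + u"
    unfolding small p_def u_def by (rule card_Un_disjoint) auto
  then have k: "card (c ` {1..n}) = p + u + q + b"
    using card_colors by (simp add: q_def b_def)
  have b1: "n \<le> 6 * p + 3 * u + 3 * q"
    using n_le_dominated by (simp add: d q_def)
  have b2: "n \<le> 2 * p + u + 4 * q" if "b = 0"
    using n_eq sum_mid_le that by (simp add: d q_def b_def)
  have b3: "n \<le> 4 * p + 2 * u + 1 + 4 * q" if "b = 1" "q \<le> 1"
    using n_le_one_big that by (simp add: d q_def b_def)
  have b4: "n \<le> 4 * p + 2 * u + 1" if "b = 0" "q = 1"
    using n_le_one_mid that by (simp add: d q_def b_def)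
  have b5: "b \<noteq> 0" if "14 \<le> n" "2 * p + u \<le> 2"
    using big_nonempty that by (simp add: d b_def)
  have b6: "p + u \<noteq> 0" if "1 \<le> n"
  proof -
    have "small_verts \<noteq> {}"
      using end_dominated[of 1] that by blast
    then have "card small_verts \<noteq> 0"
      by simp
    then show ?thesis
      using d by simp
  qed
  show "6 \<le> n \<Longrightarrow> 3 \<le> card (c ` {1..n})"
    and "11 \<le> n \<Longrightarrow> 4 \<le> card (c ` {1..n})"
    and "14 \<le> n \<Longrightarrow> n + 12 \<le> 6 * card (c ` {1..n})"
    using path_class_count_arith[OF b1 b2 b3 b4 b5 b6 k] by blast+
qed

end

subsection \<open>Upper bounds\<close>

text \<open>One member is half of a class of size at most two, and two neighbours are half of a
  class of size at most four.\<close>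

lemma path_md_coloringI:
  assumes adj: "\<And>v. 1 \<le> v \<Longrightarrow> v < n \<Longrightarrow> c v \<noteq> c (v + 1)"
    and dom: "\<And>v. v \<in> {1..n} \<Longrightarrow>
      (\<exists>u \<in> {v - 1..v + 1} \<inter> {1..n}. card (color_class n c (c u)) \<le> 2) \<or>
      1 < v \<and> v < n \<and> c (v - 1) = c (v + 1) \<and> card (color_class n c (c (v + 1))) \<le> 4"
  shows "path_md_coloring n c"
proof
  fix v assume v: "v \<in> {1..n}"
  from dom[OF v] show "\<exists>i \<in> c ` {1..n}. card (color_class n c i) \<le> 2 * card ({v - 1..v + 1} \<inter> color_class n c i)"
  proof (elim disjE bexE conjE)
    fix u assume u: "u \<in> {v - 1..v + 1} \<inter> {1..n}" "card (color_class n c (c u)) \<le> 2"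
    then have "{u} \<subseteq> {v - 1..v + 1} \<inter> color_class n c (c u)"
      by (auto simp: color_class_def)
    then have "card {u} \<le> card ({v - 1..v + 1} \<inter> color_class n c (c u))"
      by (intro card_mono) auto
    then show ?thesis
      using u by (intro bexI[of _ "c u"]) auto
  next
    assume *: "1 < v" "v < n" "c (v - 1) = c (v + 1)" "card (color_class n c (c (v + 1))) \<le> 4"
    then have "{v - 1, v + 1} \<subseteq> {v - 1..v + 1} \<inter> color_class n c (c (v + 1))"
      by (auto simp: color_class_def)
    then have "card {v - 1, v + 1} \<le> card ({v - 1..v + 1} \<inter> color_class n c (c (v + 1)))"
      by (intro card_mono) auto
    then show ?thesis
      using * by (intro bexI[of _ "c (v + 1)"]) auto
  qed
qed (rule adj)

section \<open>The general coloring\<close>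

lemma md_chromatic_number_path_le_general:
  assumes "1 < n"
  shows "md_chromatic_number (path_graph n) \<le> (n + 5) div 6 + 2"
proof -
  \<comment> \<open>Residue \<open>2\<close> dominates everything except \<open>n\<close> when
    \<open>n\<close> has residue \<open>1\<close>, as its successor is missing. The offset
    \<open>2\<close> in \<open>c\<close> keeps the new colors apart from the residues
    \<open>0\<close> and \<open>1\<close>.\<close>
  define small where "small v \<longleftrightarrow> v mod 3 = 2 \<or> v = n \<and> v mod 3 = 1" for v
  define c where "c v = (if small v then 2 + v div 6 else v mod 3)" for v
  have c_ge: "2 \<le> c v \<longleftrightarrow> small v" for v
    by (auto simp: c_def small_def)
  have pair: "card (color_class n c (c u)) \<le> 2" if u: "small u" for u
  proof -
    let ?S = "color_class n c (c u)"
    have S: "small v" "v div 6 = u div 6" "v \<le> n" if "v \<in> ?S" for v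
      using that u c_ge[of u] c_ge[of v] by (auto simp: color_class_def c_def)
    \<comment> \<open>A color covers six consecutive numbers, that is two blocks of three. A block
      has only one small vertex: if \<open>n\<close> is its middle, its last number exceeds
      \<open>n\<close>.\<close>
    have "inj_on (\<lambda>v. v div 3) ?S"
    proof (rule inj_onI)
      fix x y assume "x \<in> ?S" "y \<in> ?S" "x div 3 = y div 3"
      then have *: "small x" "small y" "x \<le> n" "y \<le> n" "x div 3 = y div 3"
        using S by blast+
      define w where "w = x div 3"
      have "x = 3 * w + x mod 3" "y = 3 * w + y mod 3"
        using *(5) by (metis w_def mult_div_mod_eq)+
      then show "x = y"
        using *(1-4) unfolding small_def by (elim disjE conjE) linarith+
    qed
    moreover have "(\<lambda>v. v div 3) ` ?S \<subseteq> {2 * (u div 6), 2 * (u div 6) + 1}"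
    proof
      fix w assume "w \<in> (\<lambda>v. v div 3) ` ?S"
      then obtain v where "w = v div 3" "v div 6 = u div 6"
        using S by blast
      then have "w div 2 = u div 6"
        by (simp flip: div_mult2_eq)
      then have "w = 2 * (u div 6) \<or> w = 2 * (u div 6) + 1"
        by linarith
      then show "w \<in> {2 * (u div 6), 2 * (u div 6) + 1}"
        by simp
    qed
    ultimately have "card ?S \<le> card {2 * (u div 6), 2 * (u div 6) + 1}"
      by (intro card_inj_on_le) auto
    then show ?thesis
      by simp
  qed
  have "path_md_coloring n c"
  proof (rule path_md_coloringI)
    fix v assume v: "1 \<le> v" "v < n"
    show "c v \<noteq> c (v + 1)"
    proof (cases "small v \<or> small (v + 1)")
      case True
      then have "\<not> (small v \<and> small (v + 1))"
        using v by (auto simp: small_def mod_Suc split: if_splits)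
      then show ?thesis
        using True c_ge by metis
    next
      case False
      then show ?thesis
        by (simp add: c_def mod_Suc)
    qed
  next
    fix v assume v: "v \<in> {1..n}"
    have "\<exists>u. v - 1 \<le> u \<and> u \<le> v + 1 \<and> 1 \<le> u \<and> u \<le> n \<and> small u"
    proof -
      consider "v mod 3 = 0" | "v mod 3 = 1" "v < n" | "v mod 3 = 1" "v = n" | "v mod 3 = 2"
        using v by force
      then show ?thesis
      proof cases
        case 1
        then obtain w where w: "v = 3 * w"
          by (metis mod_0_imp_dvd dvdE)
        then obtain w' where "w = Suc w'"
          using v by (cases w) auto
        then have "v = 3 * w' + 3" "(3 * w' + 2) mod 3 = 2"
          using w by (simp, presburger)
        then show ?thesis
          using v unfolding small_def by (intro exI[of _ "3 * w' + 2"] conjI disjI1) simp_all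
      next
        case 2
        then have "(v + 1) mod 3 = 2"
          by (simp add: mod_Suc)
        then show ?thesis
          using 2 unfolding small_def by (intro exI[of _ "v + 1"] conjI disjI1) simp_all
      next
        case 3
        then show ?thesis
          using v unfolding small_def by (intro exI[of _ v] conjI disjI2) simp_all
      next
        case 4
        then show ?thesis
          using v unfolding small_def by (intro exI[of _ v] conjI disjI1) simp_all
      qed
    qed
    then show "(\<exists>u \<in> {v - 1..v + 1} \<inter> {1..n}. card (color_class n c (c u)) \<le> 2) \<or>
      1 < v \<and> v < n \<and> c (v - 1) = c (v + 1) \<and> card (color_class n c (c (v + 1))) \<le> 4"
      using pair by (meson IntI atLeastAtMost_iff)
  qed
  moreover have "c ` {1..n} \<subseteq> {..<(n + 5) div 6 + 2}"
  proof
    fix x assume "x \<in> c ` {1..n}"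
    then obtain v where v: "1 \<le> v" "v \<le> n" "x = c v"
      by auto
    show "x \<in> {..<(n + 5) div 6 + 2}"
    proof (cases "small v")
      case True
      then have "v mod 3 \<noteq> 0"
        by (auto simp: small_def)
      \<comment> \<open>A multiple of six is never small, so \<open>v\<close> lies strictly above
        the start of its block of six and no extra color is needed.\<close>
      then have "6 * (v div 6) \<noteq> v"
        by presburger
      then have "6 * (v div 6) < n"
        using v(2) by linarith
      then have "v div 6 < (n + 5) div 6"
        by linarith
      then show ?thesis
        using v True by (simp add: c_def)
    next
      case False
      then have "x < 2"
        using c_ge[of v] v by simp
      then show ?thesis
        by simp
    qed
  qed
  ultimately show ?thesis
    by (rule md_chromatic_number_path_le)
qed

section \<open>Short paths by evaluation\<close>

text \<open>Lists instead of sets make the conditions evaluable by rewriting with code equations.\<close>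

definition path_md_check :: "nat \<Rightarrow> (nat \<Rightarrow> nat) \<Rightarrow> nat \<Rightarrow> bool" where
  "path_md_check n c k \<longleftrightarrow>
    (let size = (\<lambda>u. length (filter (\<lambda>v. c v = c u) [1..<n + 1])) in
      list_all (\<lambda>v. c v \<noteq> c (v + 1)) [1..<n] \<and>
      list_all (\<lambda>v.
        list_ex (\<lambda>u. 1 \<le> u \<and> u \<le> n \<and> size u \<le> 2) [v - 1, v, v + 1] \<or>
        1 < v \<and> v < n \<and> c (v - 1) = c (v + 1) \<and> size (v + 1) \<le> 4) [1..<n + 1] \<and>
      list_all (\<lambda>v. c v < k) [1..<n + 1])"

lemma md_chromatic_number_path_le_check:
  assumes "path_md_check n c k"
  shows "md_chromatic_number (path_graph n) \<le> k"
proof (rule md_chromatic_number_path_le)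
  have "color_class n c i = set (filter (\<lambda>v. c v = i) [1..<n + 1])" for i
    by (auto simp: color_class_def)
  then have size: "card (color_class n c i) = length (filter (\<lambda>v. c v = i) [1..<n + 1])" for i
    by (simp only: distinct_card distinct_filter distinct_upt)
  show "path_md_coloring n c"
  proof (rule path_md_coloringI)
    fix v assume "1 \<le> v" "v < n"
    then show "c v \<noteq> c (v + 1)"
      using assms by (simp add: path_md_check_def list_all_iff Let_def)
  next
    fix v assume "v \<in> {1..n}"
    then have "v \<in> set [1..<n + 1]"
      by auto
    then have "(\<exists>u \<in> {v - 1, v, v + 1}. 1 \<le> u \<and> u \<le> n \<and> card (color_class n c (c u)) \<le> 2) \<or>
        1 < v \<and> v < n \<and> c (v - 1) = c (v + 1) \<and> card (color_class n c (c (v + 1))) \<le> 4"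
      using assms unfolding path_md_check_def list_all_iff list_ex_iff Let_def size by fastforce
    then show "(\<exists>u \<in> {v - 1..v + 1} \<inter> {1..n}. card (color_class n c (c u)) \<le> 2) \<or>
        1 < v \<and> v < n \<and> c (v - 1) = c (v + 1) \<and> card (color_class n c (c (v + 1))) \<le> 4"
      by fastforce
  qed
  show "c ` {1..n} \<subseteq> {..<k}"
    using assms by (auto simp: path_md_check_def list_all_iff Let_def)
qed

text \<open>At most two vertices are even, and each vertex is even or next to an even one.\<close>

lemma md_chromatic_number_path_le_2:
  assumes "n \<in> {2, 3, 4, 5}"
  shows "md_chromatic_number (path_graph n) \<le> 2"
proof -
  have "list_all (\<lambda>n. path_md_check n (\<lambda>v. v mod 2) 2) [2, 3, 4, 5]"
    by code_simp
  then have "path_md_check n (\<lambda>v. v mod 2) 2"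
    using assms by auto
  then show ?thesis
    by (rule md_chromatic_number_path_le_check)
qed

text \<open>
  The small vertices are \<open>2\<close> and \<open>min n 9\<close>; the vertices between them are dominated by the two
  classes of the alternating coloring, which the swapped colors of \<open>1\<close> and \<open>10\<close> keep at size at
  most four.
\<close>

lemma md_chromatic_number_path_le_3:
  assumes "n \<in> {7, 8, 9, 10}"
  shows "md_chromatic_number (path_graph n) \<le> 3"
proof -
  define c where
    "c n v = (if v = 2 \<or> v = min n 9 then 2 else if v = 1 then 0 else if v = 10 then 1 else v mod 2)"
    for n v :: nat
  have "list_all (\<lambda>n. path_md_check n (c n) 3) [7, 8, 9, 10]"
    unfolding c_def by code_simp
  then have "path_md_check n (c n) 3"
    using assms by auto
  then show ?thesis
    by (rule md_chromatic_number_path_le_check)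
qed

text \<open>The entry at index \<open>0\<close> is a dummy: vertices are numbered from \<open>1\<close>.\<close>

lemma md_chromatic_number_path_13_le: "md_chromatic_number (path_graph 13) \<le> 4"
proof -
  \<comment> \<open>The pairs \<open>{2, 6}\<close> and \<open>{9, 12}\<close> dominate all vertices
    but \<open>4\<close>, which lies between two members of \<open>{3, 5, 8, 11}\<close>.\<close>
  have "path_md_check 13 (\<lambda>v. [0, 0, 2, 1, 0, 1, 2, 0, 1, 3, 0, 1, 3, 0] ! v) 4"
    by code_simp
  then show ?thesis
    by (rule md_chromatic_number_path_le_check)
qed

theorem theorem3p7:
  fixes n :: nat
  assumes "n \<ge> 1"
  shows "md_chromatic_number (path_graph n) =
    (if n = 1 then 1
     else if 2 \<le> n \<and> n \<le> 5 then 2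
     else if 6 \<le> n \<and> n \<le> 10 then 3
     else if 11 \<le> n \<and> n \<le> 13 then 4
     else nat \<lceil>real n / 6\<rceil> + 2)"
proof -
  define k where "k = md_chromatic_number (path_graph n)"
  obtain c where "path_md_coloring n c" and c: "card (c ` {1..n}) = k"
    using md_chromatic_number_path_attained k_def by metis
  then interpret path_md_coloring n c
    by simp
  note lower = two_le_card_colors card_colors_ge
  have one: "1 \<le> k"
    using c assms by (metis One_nat_def Suc_leI atLeastAtMost_iff card_gt_0_iff empty_iff finite_atLeastAtMost finite_imageI image_is_empty le_refl)
  have upper1: "k \<le> 1" if "n = 1"
    using c that by simp
  have ceil: "nat \<lceil>real n / 6\<rceil> = (n + 5) div 6"
  proof -
    have "\<lceil>real n / 6\<rceil> = (int n + 5) div 6"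
      by (rule ceiling_unique) linarith+
    then show ?thesis
      by (simp add: nat_div_distrib nat_add_distrib)
  qed
  have range2: "n \<in> {2, 3, 4, 5}" if "2 \<le> n" "n \<le> 5"
    using that unfolding insert_iff empty_iff by linarith
  have range4: "n \<in> {7, 8, 9, 10}" if "7 \<le> n" "n \<le> 10"
    using that unfolding insert_iff empty_iff by linarith
  \<comment> \<open>The general coloring also settles \<open>6\<close>, \<open>11\<close> and
    \<open>12\<close>; for \<open>2\<close> to \<open>5\<close>, \<open>7\<close> to
    \<open>10\<close> and \<open>13\<close> its bound is one too large.\<close>
  consider "n = 1" | "2 \<le> n" "n \<le> 5" | "n = 6" | "7 \<le> n" "n \<le> 10" | "11 \<le> n" "n \<le> 12" | "n = 13" | "14 \<le> n"
    using assms by linarith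
  then show ?thesis
  proof cases
    case 2
    then show ?thesis
      using md_chromatic_number_path_le_2[OF range2] lower(1) c by (simp add: k_def)
  next
    case 4
    then show ?thesis
      using md_chromatic_number_path_le_3[OF range4] lower(2) c by (simp add: k_def)
  next
    case 6
    then show ?thesis
      using md_chromatic_number_path_13_le lower(3) c by (simp add: k_def)
  next
    case 7
    then show ?thesis
      using md_chromatic_number_path_le_general[of n] lower(4) c by (simp add: k_def ceil)
  next
    case 5
    then have "(n + 5) div 6 = 2"
      by linarith
    then show ?thesis
      using 5 md_chromatic_number_path_le_general[of n] lower(3) c by (simp add: k_def)
  qed (use one upper1 md_chromatic_number_path_le_general[of n] lower(2) c in \<open>simp_all add: k_def\<close>)
qed

end
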